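(* Let $\alpha\in(0,1)$ and $0<C,D<1$ with $C+D<3/4$. For $\Delta>0$ and $B\in\mathbb{N}$ let $$\mathcal{R}(\alpha,\Delta,B):=\left\{\frac{r}{b}\::\:\left|\alpha-\frac{r}{b}\right|<\Delta,\ (r,b)=1,\ B\leq b\leq 2B\right\},\qquad M_s(\alpha,\Delta,B):=\max_{\frac{r}{b}\in\mathcal{R}(\alpha,\Delta,B)}\left|c_0\left(\frac{r}{b}\right)\right|.$$ Then for all sufficiently large $B$, $$M_s(\alpha,B^{-C},B)\geq \frac{D}{\pi}\,B\log B.$$
   Context: For integers $b\geq 1$ and $r$ with $(r,b)=1$, the cotangent sum is $c_0\left(\frac{r}{b}\right):=-\sum_{m=1}^{b-1}\frac{m}{b}\cot\left(\frac{\pi m r}{b}\right)$. *)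

theory Defs
  imports Complex_Main
begin

text \<open>The cotangent sum is a function of the rational number \<open>q = r/b\<close>; its defining formula uses the
  representation in lowest terms with positive denominator, which is what \<^const>\<open>quotient_of\<close> returns
  (see the lemma \<open>c0_Fract\<close> below).\<close>

definition c0 :: "rat \<Rightarrow> real" where
  "c0 q = (case quotient_of q of (r, b) \<Rightarrow>
     - (\<Sum>m = 1..b - 1. real_of_int m / real_of_int b *
          cot (pi * real_of_int m * real_of_int r / real_of_int b)))"

lemma c0_Fract:
  assumes "1 \<le> b" "coprime r b"
  shows "c0 (Fract r b) = - (\<Sum>m = 1..b - 1. real_of_int m / real_of_int b *
          cot (pi * real_of_int m * real_of_int r / real_of_int b))"
  using assms by (simp add: c0_def quotient_of_Fract normalize_def coprime_iff_gcd_eq_1)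

definition fractions_near :: "real \<Rightarrow> real \<Rightarrow> nat \<Rightarrow> rat set" where
  "fractions_near \<alpha> \<Delta> B =
     {Fract r b | r b. \<bar>\<alpha> - real_of_int r / real_of_int b\<bar> < \<Delta> \<and> coprime r b \<and> 1 \<le> b \<and>
        int B \<le> b \<and> b \<le> 2 * int B}"

lemma finite_fractions_near: "finite (fractions_near \<alpha> \<Delta> B)"
proof -
  define K where "K = \<lceil>(\<bar>\<alpha>\<bar> + \<bar>\<Delta>\<bar>) * (2 * real B)\<rceil>"
  have "fractions_near \<alpha> \<Delta> B \<subseteq> (\<lambda>(r, b). Fract r b) ` ({-K..K} \<times> {1..2 * int B})"
  proof
    fix q assume "q \<in> fractions_near \<alpha> \<Delta> B"
    then obtain r b where q: "q = Fract r b" and b: "1 \<le> b" "b \<le> 2 * int B"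
      and close: "\<bar>\<alpha> - real_of_int r / real_of_int b\<bar> < \<Delta>"
      by (auto simp: fractions_near_def)
    have bB: "real_of_int b \<le> 2 * real B"
      using b(2) by linarith
    have "\<bar>real_of_int r / real_of_int b\<bar> \<le> \<bar>\<alpha>\<bar> + \<bar>\<Delta>\<bar>"
      using close by linarith
    then have "\<bar>real_of_int r\<bar> \<le> (\<bar>\<alpha>\<bar> + \<bar>\<Delta>\<bar>) * real_of_int b"
      using b(1) by (simp add: field_simps)
    also have "\<dots> \<le> (\<bar>\<alpha>\<bar> + \<bar>\<Delta>\<bar>) * (2 * real B)"
      using bB by (intro mult_left_mono) auto
    also have "\<dots> \<le> real_of_int K"
      by (simp add: K_def)
    finally have "\<bar>r\<bar> \<le> K" by linarith
    then show "q \<in> (\<lambda>(r, b). Fract r b) ` ({-K..K} \<times> {1..2 * int B})"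
      using q b by (auto intro!: image_eqI[of _ _ "(r, b)"])
  qed
  then show ?thesis by (rule finite_subset) simp
qed

text \<open>The maximum is unspecified if there are no such fractions, so a lower bound for it for large \<open>B\<close>
  includes the claim that the set is nonempty for large \<open>B\<close>.\<close>

definition M_s :: "real \<Rightarrow> real \<Rightarrow> nat \<Rightarrow> real" where
  "M_s \<alpha> \<Delta> B = Max ((\<lambda>q. \<bar>c0 q\<bar>) ` fractions_near \<alpha> \<Delta> B)"

end

theory Submission
  imports Defs "HOL-Analysis.Harmonic_Numbers" "HOL-Number_Theory.Cong"
    "HOL-Real_Asymp.Real_Asymp"
begin

text \<open>
  If \<open>s\<close> is an inverse of \<open>r\<close> modulo \<open>b\<close>, then substituting \<open>m = n s\<close> and pairing \<open>n\<close> with \<open>b - n\<close> gives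
  \<open>c0 (r/b) = 2 (\<Sum>n < b/2. (1/2 - frac (n s/b)) cot (\<pi> n/b))\<close>. When \<open>x = s/b\<close> is small, the
  terms with \<open>n \<le> 1/(2x)\<close> contribute about \<open>(b/\<pi>) ln (1/x)\<close>, and the oscillation of the sawtooth
  keeps the remaining ones above \<open>- O(b)\<close>. So it suffices to find \<open>r/b\<close> near \<open>\<alpha>\<close> such that \<open>r\<close> has
  an inverse \<open>s \<approx> B powr E\<close> with \<open>C < E < 1 - D\<close>. Take \<open>s\<close> a power of two, an odd \<open>k\<close> with
  \<open>k/s\<close> within \<open>1/s\<close> of \<open>\<alpha>\<close>, some \<open>b \<in> [B, 2B]\<close> with \<open>k b \<equiv> -1\<close> modulo \<open>s\<close>, and
  \<open>r = (1 + k b)/s\<close>; then \<open>r/b = k/s + 1/(b s)\<close>.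
\<close>

section \<open>Elementary bounds for the cotangent and for harmonic numbers\<close>

lemma cot_plus_int_pi:
  fixes x :: real
  shows "cot (x + of_int k * pi) = cot x"
  by (simp add: cot_altdef)

text \<open>Equivalent to \<open>y * cos y\<close> \<le> \<open>sin y\<close>: the difference
  \<open>sin t - t * cos t\<close> vanishes at 0 and has derivative \<open>t * sin t\<close>,
  nonnegative up to pi.\<close>

lemma cot_le_inverse:
  fixes y :: real
  assumes "0 < y" "y < pi"
  shows "cot y \<le> 1 / y"
proof -
  have "sin 0 - 0 * cos 0 \<le> sin y - y * cos y"
  proof (rule DERIV_nonneg_imp_nondecreasing[where f = "\<lambda>t. sin t - t * cos t"])
    fix t :: real assume "0 \<le> t" "t \<le> y"
    then show "\<exists>d. ((\<lambda>t. sin t - t * cos t) has_real_derivative d) (at t) \<and> 0 \<le> d"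
      using assms
      by (intro exI[of _ "t * sin t"]) (auto intro!: derivative_eq_intros mult_nonneg_nonneg sin_ge_zero)
  qed (use assms in auto)
  then show ?thesis
    using assms sin_gt_zero[of y] by (simp add: cot_def field_simps)
qed

text \<open>From \<open>cos y\<close> \<ge> \<open>1 - y^2 / 2\<close> and \<open>sin y\<close>
  \<le> \<open>y\<close> the cotangent is at least \<open>1 / y - y / 2\<close>, and
  \<open>y\<close> \<le> 2.\<close>

lemma cot_ge_inverse_minus_one:
  fixes y :: real
  assumes "0 < y" "y \<le> pi / 2"
  shows "1 / y - 1 \<le> cot y"
proof -
  have y2: "y \<le> 2" using assms pi_less_4 by linarith
  have s: "0 < sin y" using assms by (intro sin_gt_zero) auto
  have "\<bar>sin (y / 2)\<bar> \<le> \<bar>y / 2\<bar>" by (rule abs_sin_x_le_abs_x)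
  then have "(sin (y / 2))\<^sup>2 \<le> (y / 2)\<^sup>2" by (simp only: abs_le_square_iff)
  then have c: "1 - y\<^sup>2 / 2 \<le> cos y"
    using cos_double_sin[of "y / 2"] by (simp add: power_divide)
  have c0: "0 \<le> cos y" using assms by (intro cos_ge_zero) auto
  have "1 / y - 1 \<le> (1 - y\<^sup>2 / 2) / y"
    using assms y2 by (simp add: field_simps power2_eq_square)
  also have "\<dots> \<le> cos y / y" using assms c by (intro divide_right_mono) auto
  also have "\<dots> \<le> cos y / sin y"
    using assms c0 s sin_x_le_x[of y] by (intro divide_left_mono) auto
  finally show ?thesis by (simp add: cot_def)
qed

lemma cot_antimono:
  fixes y z :: real
  assumes "0 < y" "y \<le> z" "z \<le> pi / 2"
  shows "cot z \<le> cot y"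
  unfolding cot_def
  using assms
  by (intro frac_le cos_ge_zero cos_monotone_0_pi_le sin_monotone_2pi_le sin_gt_zero) auto

lemma harm_le_one_plus_ln:
  assumes "0 < n"
  shows "(harm n :: real) \<le> 1 + ln (real n)"
proof -
  obtain k where "n = Suc k" using assms by (cases n) auto
  moreover have "harm (Suc k) - ln (real (Suc k)) \<le> harm (Suc 0) - ln (real (Suc 0))"
    using decseqD[OF decseq_harm_diff_ln, of 0 k] by simp
  ultimately show ?thesis by (simp add: harm_def)
qed

section \<open>Rewriting the cotangent sum as a sawtooth sum over half the residues\<close>

text \<open>As \<open>s\<close> inverts \<open>r\<close> modulo \<open>b\<close>, the map
  \<open>m * r mod b\<close> permutes the range with inverse \<open>n * s mod b\<close>. Hence
  \<open>m / b\<close> becomes a fractional part, and the period pi of cot absorbs the reduction of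
  \<open>m * r\<close>.\<close>

lemma c0_reindex:
  fixes r b s :: int
  assumes "1 \<le> b" "coprime r b" "[r * s = 1] (mod b)"
  shows "c0 (Fract r b) =
    - (\<Sum>n = 1..b - 1. frac (real_of_int n * real_of_int s / real_of_int b) *
         cot (pi * real_of_int n / real_of_int b))"
proof -
  have inv: "(m * s) mod b * r mod b = m mod b" "(m * r) mod b * s mod b = m mod b" for m
  proof -
    have "m * (r * s) mod b = m mod b"
      using cong_scalar_left[OF assms(3), of m] by (simp only: Cong.cong_def mult_1_right)
    then show "(m * s) mod b * r mod b = m mod b" "(m * r) mod b * s mod b = m mod b"
      by (metis mod_mult_left_eq mult.assoc mult.commute)+
  qed
  \<comment> \<open>Here \<open>t'\<close> undoes multiplication by \<open>t\<close>, so a zero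
    residue of \<open>m * t\<close> would force \<open>m\<close> to be 0.\<close>
  have in_range: "(m * t) mod b \<in> {1..b - 1}"
    if "m \<in> {1..b - 1}" "\<And>u. (u * t) mod b * t' mod b = u mod b" for m t t'
  proof -
    have "(m * t) mod b * t' mod b = m" using that by simp
    then have "(m * t) mod b \<noteq> 0"
      using that(1) by (metis atLeastAtMost_iff mod_0 mult_zero_left not_one_le_zero)
    moreover have "0 \<le> (m * t) mod b" "(m * t) mod b < b" using assms(1) by auto
    ultimately show ?thesis by auto
  qed
  have "(\<Sum>m = 1..b - 1. real_of_int m / real_of_int b *
          cot (pi * real_of_int m * real_of_int r / real_of_int b)) =
        (\<Sum>n = 1..b - 1. frac (real_of_int n * real_of_int s / real_of_int b) *
         cot (pi * real_of_int n / real_of_int b))"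
  proof (rule sum.reindex_bij_witness[of _ "\<lambda>n. n * s mod b" "\<lambda>m. m * r mod b"])
    fix m assume m: "m \<in> {1..b - 1}"
    show "m * r mod b * s mod b = m" "m * s mod b * r mod b = m"
      using m inv by simp_all
    show "m * r mod b \<in> {1..b - 1}" "m * s mod b \<in> {1..b - 1}"
      using in_range[OF m inv(2)] in_range[OF m inv(1)] by blast+
    define n where "n = m * r mod b"
    have nr: "real_of_int (m * r) = real_of_int n + real_of_int (m * r div b) * real_of_int b"
      unfolding n_def by (simp flip: of_int_mult of_int_add)
    have "n * s mod b = m" using m inv unfolding n_def by simp
    then have ns: "real_of_int (n * s) = real_of_int m + real_of_int (n * s div b) * real_of_int b"
      by (metis mod_div_mult_eq of_int_add of_int_mult)
    have "frac (real_of_int n * real_of_int s / real_of_int b) =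
        frac (real_of_int m / real_of_int b + real_of_int (n * s div b))"
      using ns assms(1) by (simp add: field_simps)
    also have "\<dots> = real_of_int m / real_of_int b"
      using m by (simp add: frac_eq)
    finally have f: "frac (real_of_int n * real_of_int s / real_of_int b) = real_of_int m / real_of_int b" .
    have "pi * real_of_int m * real_of_int r / real_of_int b =
        pi * real_of_int (m * r) / real_of_int b"
      by (simp add: mult.assoc)
    also have "\<dots> = pi * real_of_int n / real_of_int b + of_int (m * r div b) * pi"
      unfolding nr using assms(1) by (simp add: field_simps)
    finally have "cot (pi * real_of_int m * real_of_int r / real_of_int b) =
        cot (pi * real_of_int n / real_of_int b)"
      by (simp only: cot_plus_int_pi)
    with f show "frac (real_of_int (m * r mod b) * real_of_int s / real_of_int b) *
         cot (pi * real_of_int (m * r mod b) / real_of_int b) =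
        real_of_int m / real_of_int b * cot (pi * real_of_int m * real_of_int r / real_of_int b)"
      unfolding n_def by simp
  qed
  then show ?thesis using assms by (simp add: c0_Fract)
qed

text \<open>Under \<open>n\<close> to \<open>b - n\<close> the cotangent changes sign and the
  fractional part \<open>u\<close> becomes \<open>1 - u\<close>, so a pair carries the weight
  \<open>2 * u - 1\<close>. Oddness of \<open>b\<close> leaves no unpaired middle term.\<close>

lemma c0_half_sum:
  fixes r b s :: int
  assumes b: "b = 2 * int h + 1" and "coprime r b" "[r * s = 1] (mod b)"
  shows "c0 (Fract r b) =
    2 * (\<Sum>n = 1..h. (1 / 2 - frac (real n * (real_of_int s / real_of_int b))) *
         cot (pi * real n / real_of_int b))"
proof -
  define F where "F n = frac (real_of_int n * real_of_int s / real_of_int b) *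
         cot (pi * real_of_int n / real_of_int b)" for n :: int
  have b1: "1 \<le> b" using b by simp
  have "coprime s b"
    using assms(3) by (metis cong_imp_coprime cong_sym coprime_1_left coprime_mult_left_iff)
  have pair: "F n + F (b - n) = - (2 * (1 / 2 - frac (real_of_int n * real_of_int s / real_of_int b)) *
         cot (pi * real_of_int n / real_of_int b))" if n: "n \<in> {1..int h}" for n
  proof -
    let ?t = "real_of_int n * real_of_int s / real_of_int b"
    \<comment> \<open>Reflection sends \<open>frac\<close> to \<open>1 - frac\<close> only away from
      the integers; an integer here would make \<open>b\<close> divide \<open>n\<close>.\<close>
    have "?t \<notin> \<int>"
    proof
      assume "?t \<in> \<int>"
      then obtain k where "?t = of_int k" by (auto elim: Ints_cases)
      then have "real_of_int (n * s) = real_of_int (k * b)" using b1 by (simp add: field_simps)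
      then have "b dvd n * s" by (metis dvd_triv_right of_int_eq_iff)
      then have "b dvd n" using \<open>coprime s b\<close>
        by (metis coprime_commute coprime_dvd_mult_left_iff)
      then show False using n b by (auto dest: zdvd_imp_le)
    qed
    moreover have "real_of_int (b - n) * real_of_int s / real_of_int b = of_int s + - ?t"
      using b1 by (simp add: field_simps)
    ultimately have f: "frac (real_of_int (b - n) * real_of_int s / real_of_int b) = 1 - frac ?t"
      by (simp only: frac_add_of_int_left frac_neg if_False)
    have "pi * real_of_int (b - n) / real_of_int b =
        - (pi * real_of_int n / real_of_int b) + of_int 1 * pi"
      using b1 by (simp add: field_simps)
    then have c: "cot (pi * real_of_int (b - n) / real_of_int b) = - cot (pi * real_of_int n / real_of_int b)"
      by (simp only: cot_plus_int_pi cot_minus)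
    show ?thesis unfolding F_def f c by (simp add: algebra_simps)
  qed
  have "{1..b - 1} = {1..int h} \<union> {int h + 1..b - 1}" using b by auto
  then have "sum F {1..b - 1} = sum F {1..int h} + sum F {int h + 1..b - 1}"
    by (simp add: sum.union_disjoint)
  also have "sum F {int h + 1..b - 1} = (\<Sum>n = 1..int h. F (b - n))"
    by (rule sum.reindex_bij_witness[of _ "\<lambda>n. b - n" "\<lambda>n. b - n"]) (use b in auto)
  also have "sum F {1..int h} + (\<Sum>n = 1..int h. F (b - n)) =
      (\<Sum>n = 1..int h. - (2 * (1 / 2 - frac (real_of_int n * real_of_int s / real_of_int b)) *
         cot (pi * real_of_int n / real_of_int b)))"
    unfolding sum.distrib[symmetric] by (intro sum.cong refl pair)
  also have "\<dots> = (\<Sum>n = 1..h. - (2 * (1 / 2 - frac (real n * (real_of_int s / real_of_int b))) *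
         cot (pi * real n / real_of_int b)))"
    by (rule sum.reindex_bij_witness[of _ int nat]) auto
  also have "\<dots> = - (2 * (\<Sum>n = 1..h. (1 / 2 - frac (real n * (real_of_int s / real_of_int b))) *
         cot (pi * real n / real_of_int b)))"
    by (simp only: sum_negf sum_distrib_left mult.assoc)
  finally show ?thesis
    using c0_reindex[OF b1 assms(2,3)] unfolding F_def by (simp only: minus_minus)
qed

section \<open>Lower bound for the sawtooth-cotangent sum\<close>

text \<open>The periodic parabola \<open>frac t * (1 - frac t) / 2\<close> is a discrete primitive of the sawtooth, up to
  a loss of at most \<open>x\<^sup>2 / 2\<close> per step. Summation by parts against it bounds the oscillating tail of
  the cotangent sum.\<close>

lemma sawtooth_ge_parabola_diff:
  fixes x t :: real
  assumes "0 \<le> x" "x \<le> 1"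
  shows "frac t * (1 - frac t) / 2 - frac (t - x) * (1 - frac (t - x)) / 2 - x\<^sup>2 / 2
    \<le> (1 / 2 - frac t) * x"
proof -
  define u where "u = frac t"
  have u: "0 \<le> u" "u < 1" by (auto simp: u_def frac_lt_1)
  have "t - x = u - x + of_int \<lfloor>t\<rfloor>" by (simp add: u_def frac_def)
  then have tx: "frac (t - x) = frac (u - x)" by (simp only: frac_add_of_int_right)
  show ?thesis
  \<comment> \<open>If no integer is crossed between \<open>t - x\<close> and \<open>t\<close>, both
    sides agree; otherwise they differ by \<open>x - u > 0\<close> in the right direction.\<close>
  proof (cases "x \<le> u")
    case True
    then have eq: "frac (t - x) = u - x" using tx u assms by (simp add: frac_eq)
    show ?thesis unfolding eq u_def[symmetric] by (simp add: field_simps power2_eq_square)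
  next
    case False
    then have "frac (u - x + 1) = u - x + 1" using u assms by (subst frac_eq) auto
    then have eq: "frac (t - x) = u - x + 1" using tx by (simp add: frac_1_eq)
    show ?thesis using False unfolding eq u_def[symmetric]
      by (simp add: field_simps power2_eq_square)
  qed
qed

text \<open>Summation by parts: the interior terms \<open>g n * (f n - f (Suc n))\<close> are
  nonnegative, so only the boundary terms survive.\<close>

lemma sum_diff_antimono_ge:
  fixes g f :: "nat \<Rightarrow> real"
  assumes "m < h"
    and g: "\<And>n. 0 \<le> g n"
    and f: "\<And>n. m < n \<Longrightarrow> n < h \<Longrightarrow> f (Suc n) \<le> f n"
  shows "g h * f h - g m * f (Suc m) \<le> (\<Sum>n = Suc m..h. (g n - g (n - 1)) * f n)"
  using assms(1) f
proof (induction h)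
  case 0
  then show ?case by simp
next
  case (Suc h)
  show ?case
  proof (cases "m = h")
    case True
    then show ?thesis by (simp add: algebra_simps)
  next
    case False
    then have "m < h" using Suc.prems by simp
    then have IH: "g h * f h - g m * f (Suc m) \<le> (\<Sum>n = Suc m..h. (g n - g (n - 1)) * f n)"
      using Suc by simp
    have "g h * f (Suc h) \<le> g h * f h"
      using g Suc.prems(2)[of h] \<open>m < h\<close> by (intro mult_left_mono) auto
    with IH show ?thesis using \<open>m < h\<close> by (simp add: algebra_simps)
  qed
qed


lemma sawtooth_cot_sum_ge:
  fixes x b :: real and h :: nat
  assumes b: "b = 2 * real h + 1" and x: "1 / b \<le> x" "x \<le> 1"
  shows "b / pi * (- ln x - 5 - x * (1 + ln b)) \<le>
    2 * (\<Sum>n = 1..h. (1 / 2 - frac (real n * x)) * cot (pi * real n / b))"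
proof -
  define f where "f n = cot (pi * real n / b)" for n :: nat
  define a where "a n = 1 / 2 - frac (real n * x)" for n :: nat
  define g where "g n = frac (real n * x) * (1 - frac (real n * x)) / 2" for n :: nat
  \<comment> \<open>The cutoff: up to \<open>m\<close> the product \<open>n * x\<close> stays below
    1/2 and the sawtooth is linear; just beyond it \<open>f\<close> is already of size
    O(\<open>b * x\<close>), which compensates the division by \<open>x\<close> in the summation by
    parts.\<close>
  define m where "m = nat \<lfloor>1 / (2 * x)\<rfloor>"
  have b1: "1 \<le> b" using b by simp
  have x0: "0 < x" using b1 x(1) by (auto intro: less_le_trans[of _ "1 / b"])
  have m: "real m \<le> 1 / (2 * x)" "1 / (2 * x) < real m + 1"
    using x0 floor_correct[of "1 / (2 * x)"] by (auto simp: m_def le_nat_floor)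
  \<comment> \<open>The assumption \<open>1 / b\<close> \<le> \<open>x\<close> keeps the cutoff in
    range, since \<open>b / 2 = h + 1 / 2\<close>.\<close>
  have "1 / (2 * x) \<le> b / 2" using x(1) x0 b1 by (simp add: field_simps)
  then have mh: "m \<le> h" using m(1) b by linarith
  have range: "0 < pi * real n / b" "pi * real n / b \<le> pi / 2" if "1 \<le> n" "n \<le> h" for n
  proof -
    show "0 < pi * real n / b" using that b1 by simp
    have "pi * (real n * 2) \<le> pi * b" using that b by (intro mult_left_mono) auto
    then show "pi * real n / b \<le> pi / 2" using b1 by (simp add: field_simps)
  qed
  have f_le: "f n \<le> b / pi * inverse (real n)" if "1 \<le> n" "n \<le> h" for n
    using cot_le_inverse[of "pi * real n / b"] range[OF that] pi_gt_zero
    by (simp add: f_def field_simps)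
  have f_ge: "b / pi * inverse (real n) - 1 \<le> f n" if "1 \<le> n" "n \<le> h" for n
    using cot_ge_inverse_minus_one[of "pi * real n / b"] range[OF that]
    by (simp add: f_def field_simps)
  have f_mono: "f (Suc n) \<le> f n" if "1 \<le> n" "n < h" for n
    unfolding f_def using range[of n] range[of "Suc n"] that b1
    by (intro cot_antimono) (auto intro!: divide_right_mono mult_left_mono)
  have f_nonneg: "0 \<le> f n" if "1 \<le> n" "n \<le> h" for n
    using cot_antimono[OF range(1)[OF that] range(2)[OF that]] by (simp add: f_def cot_def)
  have g: "0 \<le> g n" "g n \<le> 1 / 8" for n
  proof -
    show "0 \<le> g n" by (simp add: g_def frac_lt_1 less_imp_le)
    have "0 \<le> (frac (real n * x) - 1 / 2)\<^sup>2" by simp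
    then show "g n \<le> 1 / 8" by (simp add: g_def power2_eq_square field_simps)
  qed

  \<comment> \<open>Each linear correction \<open>n * x * f n\<close> is at most
    \<open>x * b / pi\<close>, and \<open>m * x\<close> \<le> 1/2 bounds their total.\<close>
  have head: "(\<Sum>n = 1..m. f n) / 2 - b / pi / 2 \<le> (\<Sum>n = 1..m. a n * f n)"
  proof -
    have "f n / 2 - x * b / pi \<le> a n * f n" if n: "n \<in> {1..m}" for n
    proof -
      have "real n * x \<le> real m * x" using n x0 by (intro mult_right_mono) auto
      also have "\<dots> \<le> 1 / 2" using m(1) x0 by (simp add: field_simps)
      finally have "frac (real n * x) = real n * x" using x0 by (simp add: frac_eq)
      moreover have "real n * x * f n \<le> real n * x * (b / pi * inverse (real n))"
        using f_le[of n] n mh x0 by (intro mult_left_mono) auto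
      moreover have "real n * x * (b / pi * inverse (real n)) = x * b / pi" using n by simp
      ultimately show ?thesis by (simp only: a_def left_diff_distrib)
    qed
    then have "(\<Sum>n = 1..m. f n / 2 - x * b / pi) \<le> (\<Sum>n = 1..m. a n * f n)"
      by (intro sum_mono)
    moreover have "(\<Sum>n = 1..m. f n / 2 - x * b / pi) =
        (\<Sum>n = 1..m. f n) / 2 - (real m * x) * (b / pi)"
      by (simp add: sum_subtractf sum_divide_distrib)
    moreover have "(real m * x) * (b / pi) \<le> 1 / 2 * (b / pi)"
      using m(1) x0 b1 by (intro mult_right_mono) (auto simp: field_simps)
    ultimately show ?thesis by simp
  qed

  have tail: "- (b / pi / 4) - x / 2 * (\<Sum>n = Suc m..h. f n) \<le> (\<Sum>n = Suc m..h. a n * f n)"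
  proof (cases "m < h")
    case True
    have "(g n - g (n - 1)) * f n / x - x / 2 * f n \<le> a n * f n" if n: "n \<in> {Suc m..h}" for n
    proof -
      have "real n * x - x = real (n - 1) * x" using n by (simp add: algebra_simps)
      then have "g n - g (n - 1) - x\<^sup>2 / 2 \<le> a n * x"
        using sawtooth_ge_parabola_diff[of x "real n * x"] x0 x(2) by (simp add: g_def a_def)
      then have "(g n - g (n - 1)) / x - x / 2 \<le> a n"
        using x0 by (simp add: field_simps power2_eq_square)
      then have "((g n - g (n - 1)) / x - x / 2) * f n \<le> a n * f n"
        using f_nonneg[of n] n by (intro mult_right_mono) auto
      then show ?thesis by (simp add: algebra_simps)
    qed
    then have "(\<Sum>n = Suc m..h. (g n - g (n - 1)) * f n / x - x / 2 * f n)
        \<le> (\<Sum>n = Suc m..h. a n * f n)"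
      by (intro sum_mono)
    moreover have "(\<Sum>n = Suc m..h. (g n - g (n - 1)) * f n / x - x / 2 * f n) =
        (\<Sum>n = Suc m..h. (g n - g (n - 1)) * f n) / x - x / 2 * (\<Sum>n = Suc m..h. f n)"
      by (simp add: sum_subtractf sum_divide_distrib sum_distrib_left)
    \<comment> \<open>Only the boundary term at \<open>m\<close> can be negative; it is at most 1/8,
      the maximum of the parabola, times \<open>f (Suc m)\<close> \<le>
      \<open>2 * x * b / pi\<close>.\<close>
    moreover have "- b * x / (4 * pi) \<le> (\<Sum>n = Suc m..h. (g n - g (n - 1)) * f n)"
    proof -
      have "inverse (real (Suc m)) \<le> 2 * x" using m(2) x0 by (simp add: field_simps)
      then have "b / pi * inverse (real (Suc m)) \<le> b / pi * (2 * x)"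
        using b1 by (intro mult_left_mono) auto
      then have "f (Suc m) \<le> b / pi * (2 * x)" using f_le[of "Suc m"] True by simp
      then have "g m * f (Suc m) \<le> 1 / 8 * (b / pi * (2 * x))"
        using g f_nonneg[of "Suc m"] True by (intro mult_mono) auto
      moreover have "0 \<le> g h * f h" using g f_nonneg[of h] True by simp
      moreover have "g h * f h - g m * f (Suc m) \<le> (\<Sum>n = Suc m..h. (g n - g (n - 1)) * f n)"
        using True g f_mono by (intro sum_diff_antimono_ge) auto
      ultimately show ?thesis by simp
    qed
    then have "- b * x / (4 * pi) / x \<le> (\<Sum>n = Suc m..h. (g n - g (n - 1)) * f n) / x"
      using x0 by (intro divide_right_mono) auto
    ultimately show ?thesis using x0 by simp
  next
    case False
    then show ?thesis using mh b1 by simp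
  qed

  \<comment> \<open>The loss \<open>x^2 / 2\<close> per step accumulates to \<open>x / 2\<close>
    times a harmonic sum; this gives the term \<open>x * (1 + ln b)\<close>.\<close>
  have "(\<Sum>n = Suc m..h. f n) \<le> (\<Sum>n = 1..h. f n)"
    using f_nonneg by (intro sum_mono2) auto
  also have "\<dots> \<le> (\<Sum>n = 1..h. b / pi * inverse (real n))" using f_le by (intro sum_mono) auto
  also have "\<dots> = b / pi * harm h" by (simp add: harm_def sum_distrib_left)
  also have "\<dots> \<le> b / pi * (1 + ln b)"
  proof (intro mult_left_mono)
    show "harm h \<le> 1 + ln b"
    proof (cases "h = 0")
      case True
      then show ?thesis using b by (simp add: harm_def)
    next
      case False
      then have "ln (real h) \<le> ln b" using b by simp
      then show ?thesis using harm_le_one_plus_ln[of h] False by simp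
    qed
  qed (use b1 in auto)
  finally have upper: "x / 2 * (\<Sum>n = Suc m..h. f n) \<le> x / 2 * (b / pi * (1 + ln b))"
    using x0 by (intro mult_left_mono) auto

  \<comment> \<open>The main term comes from \<open>harm m\<close> \<ge>
    \<open>ln (1 / (2 * x))\<close>. The loss of 1 per cotangent costs \<open>m\<close> \<le>
    \<open>b / 2\<close>, which is \<open>pi / 2\<close> in units of \<open>b / pi\<close>.\<close>
  have "b / pi * (- ln x - 1 - pi / 2) \<le> b / pi * harm m - real m"
  proof -
    have "- ln x - ln 2 = ln (1 / (2 * x))" using x0 by (simp add: ln_div ln_mult)
    also have "\<dots> \<le> ln (real m + 1)" using m(2) x0 by simp
    also have "\<dots> \<le> harm m" by (rule ln_le_harm)
    finally have "- ln x - 1 \<le> harm m" using ln_2_less_1 by simp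
    then have "b / pi * (- ln x - 1) \<le> b / pi * harm m" using b1 by (intro mult_left_mono) auto
    moreover have "real m \<le> b / 2" using mh b by simp
    ultimately show ?thesis by (simp add: algebra_simps)
  qed
  also have "\<dots> = (\<Sum>n = 1..m. b / pi * inverse (real n) - 1)"
    by (simp add: harm_def sum_distrib_left sum_subtractf)
  also have "\<dots> \<le> (\<Sum>n = 1..m. f n)" using f_ge mh by (intro sum_mono) auto
  finally have lower: "b / pi * (- ln x - 1 - pi / 2) \<le> (\<Sum>n = 1..m. f n)" .

  have "(\<Sum>n = 1..h. a n * f n) = (\<Sum>n = 1..m. a n * f n) + (\<Sum>n = Suc m..h. a n * f n)"
    using mh sum.ub_add_nat[of 1 m "\<lambda>n. a n * f n" "h - m"] by simp
  then have "2 * (\<Sum>n = 1..h. a n * f n) \<ge>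
      b / pi * (- ln x - 1 - pi / 2) - b / pi - b / pi / 2 - x * (b / pi * (1 + ln b))"
    using head tail upper lower by (simp add: algebra_simps)
  moreover have "b / pi * (- ln x - 1 - pi / 2) - b / pi - b / pi / 2 - x * (b / pi * (1 + ln b))
      = b / pi * (- ln x - 5 / 2 - pi / 2 - x * (1 + ln b))"
    by (simp add: field_simps)
  \<comment> \<open>The collected constant \<open>5 / 2 + pi / 2\<close> is below 5 because pi <
    4.\<close>
  moreover have "b / pi * (- ln x - 5 - x * (1 + ln b))
      \<le> b / pi * (- ln x - 5 / 2 - pi / 2 - x * (1 + ln b))"
    using b1 pi_less_4 by (intro mult_left_mono) auto
  ultimately show ?thesis unfolding a_def f_def by linarith
qed

section \<open>Fractions near \<alpha> whose numerator has a prescribed inverse\<close>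

text \<open>Everything follows from the identity \<open>s * r - k * b = 1\<close>: coprimality, the
  inverse modulo \<open>b\<close>, and the distance \<open>1 / (b * s)\<close> from
  \<open>r / b\<close> to \<open>k / s\<close>.\<close>

lemma ex_fraction_with_inverse_power_of_two:
  fixes \<alpha> :: real and j B :: nat
  assumes "0 < j" "2 ^ j \<le> B"
  obtains r :: int and h :: nat where
    "coprime r (2 * int h + 1)" "[r * 2 ^ j = 1] (mod (2 * int h + 1))"
    "int B \<le> 2 * int h + 1" "2 * int h + 1 \<le> 2 * int B"
    "\<bar>\<alpha> - real_of_int r / real_of_int (2 * int h + 1)\<bar> \<le> 2 / 2 ^ j"
proof -
  define s :: int where "s = 2 ^ j"
  have s: "0 < s" "even s" using assms(1) by (simp_all add: s_def)
  have sB: "s \<le> int B"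
    unfolding s_def using assms(2) by (metis of_nat_le_iff of_nat_numeral of_nat_power)
  \<comment> \<open>An odd integer nearest to \<open>\<alpha> * s\<close>; odd numbers are coprime
    to the power of two \<open>s\<close>.\<close>
  define k where "k = 2 * \<lfloor>\<alpha> * real_of_int s / 2\<rfloor> + 1"
  have k_close: "\<bar>\<alpha> * real_of_int s - real_of_int k\<bar> \<le> 1" unfolding k_def by linarith
  have "coprime k s" unfolding s_def k_def by simp
  then obtain y where y: "[k * y = 1] (mod s)" using cong_solve_coprime_int by blast
  \<comment> \<open>The least integer from \<open>B\<close> on that is congruent to
    \<open>- y\<close> modulo \<open>s\<close>; \<open>s\<close> \<le> \<open>B\<close> keeps it
    below \<open>2 * B\<close>.\<close>
  define b where "b = int B + (- y - int B) mod s"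
  have b: "int B \<le> b" "b \<le> 2 * int B" "1 \<le> b"
    using s(1) sB pos_mod_sign[OF s(1), of "- y - int B"] pos_mod_bound[OF s(1), of "- y - int B"]
    unfolding b_def by linarith+
  have "[b = - y] (mod s)" by (simp add: b_def Cong.cong_def mod_simps)
  then have "[k * b = k * - y] (mod s)" by (rule cong_scalar_left)
  also have "[k * - y = - 1] (mod s)" using y by (simp add: cong_minus_minus_iff)
  finally have "s dvd 1 + k * b" by (simp add: cong_iff_dvd_diff add.commute)
  then obtain r where r: "1 + k * b = s * r" by (elim dvdE)
  \<comment> \<open>Since \<open>j > 0\<close>, \<open>s\<close> is even and \<open>b\<close> must
    be odd, as the half-range form of the sum requires.\<close>
  have "even (1 + k * b)" unfolding r using s(2) by simp
  then have "odd b" by auto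
  then obtain l where l: "b = 2 * l + 1" by (elim oddE)
  then have h: "b = 2 * int (nat l) + 1" using b by simp
  have "coprime r b"
  proof (rule coprimeI)
    fix d assume "d dvd r" "d dvd b"
    then have "d dvd s * r - k * b" by simp
    also have "s * r - k * b = 1" using r by linarith
    finally show "is_unit d" .
  qed
  moreover have "[r * 2 ^ j = 1] (mod b)"
    unfolding s_def[symmetric] mult.commute[of r] r[symmetric] by (simp add: cong_iff_dvd_diff)
  moreover have "\<bar>\<alpha> - real_of_int r / real_of_int b\<bar> \<le> 2 / 2 ^ j"
  proof -
    have "1 + real_of_int k * real_of_int b = real_of_int s * real_of_int r"
      using r by (metis of_int_1 of_int_add of_int_mult)
    then have "real_of_int r = (1 + real_of_int k * real_of_int b) / real_of_int s"
      using s by (simp add: field_simps)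
    then have "\<alpha> - real_of_int r / real_of_int b =
        (\<alpha> * real_of_int s - real_of_int k) / real_of_int s - 1 / real_of_int b / real_of_int s"
      using s b by (simp only:) (simp add: field_simps)
    also have "\<bar>\<dots>\<bar> \<le> 1 / real_of_int s + 1 / real_of_int s"
    proof -
      have "\<bar>(\<alpha> * real_of_int s - real_of_int k) / real_of_int s\<bar> \<le> 1 / real_of_int s"
        using k_close s by (simp add: divide_right_mono)
      moreover have "1 / real_of_int b / real_of_int s \<le> 1 / real_of_int s"
        using b s by (intro divide_right_mono) auto
      moreover have "0 \<le> 1 / real_of_int b / real_of_int s" using b s by simp
      ultimately show ?thesis by linarith
    qed
    finally show ?thesis by (simp add: s_def)
  qed
  ultimately show thesis using that[of r "nat l"] b h by simp
qed

section \<open>Passing to the maximum and choosing the parameters\<close>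

text \<open>Frees the estimate from the unknown \<open>b\<close> between \<open>B\<close> and
  \<open>2 * B\<close>: the condition on \<open>L\<close> uses the largest possible \<open>x\<close>
  and \<open>ln b\<close>, and \<open>0\<close> \<le> \<open>L\<close> allows the factor
  \<open>b\<close> to be lowered to \<open>B\<close>.\<close>

lemma M_s_ge_of_power_of_two:
  fixes \<alpha> \<Delta> L :: real and j B :: nat
  assumes "0 < j" "2 ^ j \<le> B" "2 / 2 ^ j < \<Delta>" and "0 \<le> L"
    and L: "L \<le> - ln (2 ^ j / real B) - 5 - 2 ^ j / real B * (1 + ln (2 * real B))"
  shows "real B / pi * L \<le> M_s \<alpha> \<Delta> B"
proof -
  obtain r h where *:
    "coprime r (2 * int h + 1)" "[r * 2 ^ j = 1] (mod (2 * int h + 1))"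
    "int B \<le> 2 * int h + 1" "2 * int h + 1 \<le> 2 * int B"
    "\<bar>\<alpha> - real_of_int r / real_of_int (2 * int h + 1)\<bar> \<le> 2 / 2 ^ j"
    using ex_fraction_with_inverse_power_of_two[OF assms(1,2)] by metis
  define b where "b = 2 * int h + 1"
  define x where "x = 2 ^ j / real_of_int b"
  have B: "(2::real) ^ j \<le> real B" "0 < real B"
    using assms(2) by (metis of_nat_le_iff of_nat_numeral of_nat_power)
      (use assms(2) in \<open>auto intro!: gr0I\<close>)
  have b: "real B \<le> real_of_int b" "real_of_int b \<le> 2 * real B" "1 \<le> b"
    using *(3,4) unfolding b_def by linarith+
  have "2 ^ j \<le> b"
    using assms(2) *(3) unfolding b_def
    by (metis of_nat_le_iff of_nat_numeral of_nat_power order_trans)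
  then have x: "0 < x" "x \<le> 2 ^ j / real B" "x \<le> 1" "1 / real_of_int b \<le> x"
    using b B by (auto simp: x_def intro!: divide_left_mono divide_right_mono)
  have "x * (1 + ln (real_of_int b)) \<le> 2 ^ j / real B * (1 + ln (2 * real B))"
    using x b B by (intro mult_mono add_left_mono) auto
  moreover have "ln x \<le> ln (2 ^ j / real B)" using x B by simp
  ultimately have L': "L \<le> - ln x - 5 - x * (1 + ln (real_of_int b))" using L by linarith
  have "real B / pi * L \<le> real_of_int b / pi * (- ln x - 5 - x * (1 + ln (real_of_int b)))"
    using b L' \<open>0 \<le> L\<close> by (intro mult_mono divide_right_mono) auto
  also have "\<dots> \<le> 2 * (\<Sum>n = 1..h. (1 / 2 - frac (real n * x)) * cot (pi * real n / real_of_int b))"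
    using x by (intro sawtooth_cot_sum_ge) (auto simp: b_def)
  also have "\<dots> = c0 (Fract r b)"
    using c0_half_sum[OF b_def, of r "2 ^ j"] *(1,2) by (simp add: x_def b_def)
  also have "\<dots> \<le> \<bar>c0 (Fract r b)\<bar>" by simp
  also have "\<dots> \<le> M_s \<alpha> \<Delta> B"
    unfolding M_s_def
  \<comment> \<open>Membership also shows that the set is nonempty, so \<open>Max\<close> is a
    genuine maximum.\<close>
  proof (intro Max_ge finite_imageI finite_fractions_near imageI)
    show "Fract r b \<in> fractions_near \<alpha> \<Delta> B"
      using * b assms(3) unfolding fractions_near_def b_def[symmetric] by fastforce
  qed
  finally show ?thesis .
qed

theorem theorem1p5:
  fixes \<alpha> C D :: real
  assumes "0 < \<alpha>" "\<alpha> < 1"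
    and "0 < C" "C < 1"
    and "0 < D" "D < 1"
    and "C + D < 3 / 4"
  shows "\<forall>\<^sub>F B in sequentially. M_s \<alpha> (real B powr (- C)) B \<ge> D / pi * real B * ln (real B)"
proof -
  \<comment> \<open>The midpoint of \<open>C\<close> and \<open>1 - D\<close>, which are in this
    order because \<open>C + D < 1\<close>. The inverse will have size about
    \<open>B powr E\<close>: \<open>E > C\<close> gives closeness to \<alpha>,
    \<open>E < 1 - D\<close> gives the constant \<open>D\<close>.\<close>
  define E where "E = (1 - D + C) / 2"
  have E: "C < E" "E < 1 - D" "0 < E" "E < 1" using assms by (auto simp: E_def)
  have "\<forall>\<^sub>F B :: nat in sequentially. 2 \<le> real B powr E"
    using E by real_asymp
  moreover have "\<forall>\<^sub>F B :: nat in sequentially. 4 * real B powr (- E) < real B powr (- C)"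
    using E by real_asymp
  moreover have "\<forall>\<^sub>F B :: nat in sequentially. D * ln (real B) \<le>
      (1 - E) * ln (real B) - 5 - real B powr (E - 1) * (1 + ln (2 * real B))"
  proof -
    have "((\<lambda>B :: nat. real B powr (E - 1) * (1 + ln (2 * real B))) \<longlongrightarrow> 0) sequentially"
      using E by real_asymp
    then have "\<forall>\<^sub>F B in sequentially. real B powr (E - 1) * (1 + ln (2 * real B)) < 1"
      by (rule order_tendstoD) simp
    moreover have "filterlim (\<lambda>B :: nat. (1 - E - D) * ln (real B)) at_top sequentially"
      using E by real_asymp
    \<comment> \<open>The slack 6 pays for the constant 5 and for the vanishing term, which is below
      1.\<close>
    then have "\<forall>\<^sub>F B :: nat in sequentially. 6 \<le> (1 - E - D) * ln (real B)"
      by (simp add: filterlim_at_top)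
    ultimately show ?thesis by eventually_elim (simp add: algebra_simps)
  qed
  ultimately show ?thesis using eventually_gt_at_top[of 1]
  proof eventually_elim
    case (elim B)
    \<comment> \<open>The largest power of two up to \<open>K\<close> lies between half of
      \<open>B powr E\<close> and \<open>B powr E\<close>; \<open>K\<close> \<ge> 2 makes its
      exponent positive.\<close>
    define K where "K = nat \<lfloor>real B powr E\<rfloor>"
    have K: "real K \<le> real B powr E" "real B powr E < real K + 1" "2 \<le> K"
      using elim(1) floor_correct[of "real B powr E"] by (auto simp: K_def le_nat_floor)
    obtain j where j: "2 ^ j \<le> K" "K < 2 ^ (j + 1)"
      using ex_power_ivl1[of 2 K] K(3) by auto
    have "0 < j" using j(2) K(3) by (cases j) auto
    have le: "2 ^ j \<le> real B powr E"
      using j(1) K(1) by (metis of_nat_le_iff of_nat_numeral of_nat_power order_trans)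
    have "real (K + 1) \<le> real (2 ^ (j + 1))" using j(2) by (simp only: of_nat_le_iff)
    then have ge: "real B powr E < 2 * 2 ^ j" using K(2) by simp
    have "real B powr E \<le> real B" using powr_mono[of E 1 "real B"] E elim(4) by simp
    then have "2 ^ j \<le> real B" using le by linarith
    then have "2 ^ j \<le> B" by (metis of_nat_le_iff of_nat_numeral of_nat_power)
    have ratio: "2 ^ j / real B \<le> real B powr (E - 1)"
      using le elim(4) by (simp add: powr_diff divide_right_mono)
    have "real B / pi * (D * ln (real B)) \<le> M_s \<alpha> (real B powr (- C)) B"
    proof (rule M_s_ge_of_power_of_two)
      have "2 / 2 ^ j < 4 * real B powr (- E)"
        using ge elim(4) by (simp add: powr_minus field_simps)
      then show "2 / 2 ^ j < real B powr (- C)" using elim(2) by simp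
      have "ln (2 ^ j / real B) \<le> ln (real B powr (E - 1))"
        using ratio elim(4) by (subst ln_le_cancel_iff) auto
      then have "ln (2 ^ j / real B) \<le> (E - 1) * ln (real B)" using elim(4) by (simp add: ln_powr)
      moreover have "2 ^ j / real B * (1 + ln (2 * real B)) \<le>
          real B powr (E - 1) * (1 + ln (2 * real B))"
        using ratio elim(4) by (intro mult_right_mono) auto
      ultimately show "D * ln (real B) \<le>
          - ln (2 ^ j / real B) - 5 - 2 ^ j / real B * (1 + ln (2 * real B))"
        using elim(3) by (simp add: algebra_simps)
    qed (use \<open>0 < j\<close> \<open>2 ^ j \<le> B\<close> assms elim(4) in auto)
    then show ?case by (simp add: algebra_simps)
  qed
qed

end
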